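(* Let $N$ be a positive integer and let $\alpha,\beta,\zeta,\rho$ be real parameters that are generic (no denominator appearing in the formulas of the context or below vanishes). For $m,n,k\in\{0,\dots,N\}$ let $S_m(n)=\langle f_n^*,e_m\rangle$, $U_m(n)=\langle e_m,d_n^*\rangle$ (functions $e_m,f_n^*,d_n^*,z_k^*$ and pairing as in the context), and let $$R_k^{(dH)}(m;\boldsymbol\rho)={}_3F_2\left({-k,\ -m,\ m-2\beta-2\zeta-1\atop N-2\alpha-\beta-2\zeta,\ -N};1\right)=\frac{k!\,(m-2\beta-2\zeta-1)_m}{(-N,N-2\alpha-\beta-2\zeta)_m}\,\langle e_m,z_k^*\rangle$$ be the dual Hahn polynomial with parameters $\boldsymbol\rho=(N-2\alpha-\beta-2\zeta-1,\ 2\alpha-\beta-N-1,\ N)$. Let $J_m^{(a,b)}$ be the Jacobi polynomial on $(0,1)$ (see context) with $a=N-2\alpha-\beta-2\zeta-1$ and $b=2\alpha-\beta-N-1$. Then $$S_m(n)=\frac{(-1)^n}{2\pi i}\frac{m!\,(-N)_m}{(-N)_n\,(m-2\beta-2\zeta-1)_m}\oint_\Gamma x^{-n-1}J_m^{(a,b)}(x)\;{}_2F_1\left({1+\beta+\rho-n,\ 1+N-n\atop 1+2\alpha+\rho-2n};x\right)dx,$$ $$U_m(n)=\frac{(-1)^n}{2\pi i}\frac{m!\,(-N)_m}{(-N)_n\,(n-\alpha)\,(m-2\beta-2\zeta-1)_m}\oint_\Gamma x^{-n-1}J_m^{(a,b)}(x)\;{}_2F_1\left({N+1-n,\ \beta-\alpha+1\atop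 \alpha-n+1};x\right)dx,$$ $$R_k^{(dH)}(m;\boldsymbol\rho)=\frac{(-1)^k}{2\pi i}\frac{m!\,k!}{(N-2\alpha-\beta-2\zeta)_m\,(-N)_k}\oint_\Gamma x^{-k-1}(1-x)^{k-1-N}J_m^{(a,b)}(x)\,dx .$$
   Context: Notation: $(a)_n=a(a+1)\cdots(a+n-1)$, $(a)_0=1$, $(a_1,\dots,a_k)_n=(a_1)_n\cdots(a_k)_n$. $\Gamma$ is the positively oriented circle $|x|=r$ with $0<r<1$, and $$\langle f,g\rangle=\frac1{2\pi i}\oint_\Gamma f(x)g(x)\,dx .$$ The Jacobi polynomials on $(0,1)$ are $J_n^{(a,b)}(x)=\frac{(a+1)_n}{n!}\,{}_2F_1\left({-n,\ n+a+b+1\atop a+1};x\right)$. Put $g_\ell(x)=(-1)^\ell(-N)_\ell\,x^\ell$ and $g_\ell^*(x)=(-1)^\ell x^{-\ell-1}/(-N)_\ell$ for $\ell=0,\dots,N$, so that $\langle g_m^*,g_n\rangle=\delta_{m,n}$. The functions are $$e_n=\frac{(-N,N-2\alpha-\beta-2\zeta)_n}{(n-2\beta-2\zeta-1)_n}\sum_{\ell=0}^{N}(-1)^\ell\frac{(-n,n-2\beta-2\zeta-1)_\ell}{\ell!\,(-N,N-2\alpha-\beta-2\zeta)_\ell}\,g_\ell,$$ $$f_n^*=\frac{(-\beta-\rho)_n}{n!\,(n-2\alpha-\rho)_n}\sum_{\ell=0}^{N}(-1)^\ell\frac{(-n,n-2\alpha-\rho)_\ell}{(-\beta-\rho)_\ell}\,g_\ell^*,$$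 $$d_n^*=\frac{(-n+\alpha-\beta)_n}{n!\,(-\alpha)_{n+1}}\sum_{\ell=0}^{N}(-1)^\ell\frac{(-n,-\alpha)_\ell}{(-n+\alpha-\beta)_\ell}\,g_\ell^*,\qquad z_n^*=\frac1{(-n)_n}\sum_{\ell=0}^{N}(-1)^{\ell+n}(-n)_\ell\,g_\ell^* .$$ (In the paper's terminology, $S_m(n)$ are the Racah polynomials up to normalization and $U_m(n)$ the rational functions of Racah type up to normalization.) *)

theory Defs
  imports "HOL-Complex_Analysis.Complex_Analysis"
begin

text \<open>
  The generalized hypergeometric series with real parameters and complex argument. For a
  terminating series the terms beyond the cut-off are \<open>0\<close>, also where a denominator factor vanishes
  there (\<open>0 / 0 = 0\<close>), so the value is the usual finite sum.
\<close>

definition hypergeo :: "real list \<Rightarrow> real list \<Rightarrow> complex \<Rightarrow> complex" where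
  "hypergeo as bs z = eval_fps (fps_hypergeo (map of_real as) (map of_real bs) 1) z"

definition jacobi_poly :: "nat \<Rightarrow> real \<Rightarrow> real \<Rightarrow> complex \<Rightarrow> complex" where
  "jacobi_poly n a b x =
     of_real (pochhammer (a + 1) n / fact n) *
     hypergeo [- real n, real n + a + b + 1] [a + 1] x"

definition dual_hahn :: "nat \<Rightarrow> nat \<Rightarrow> real \<Rightarrow> real \<Rightarrow> nat \<Rightarrow> complex" where
  "dual_hahn k m \<gamma> \<delta> N =
     hypergeo [- real k, - real m, real m + \<gamma> + \<delta> + 1] [\<gamma> + 1, - real N] 1"

definition pairing :: "real \<Rightarrow> (complex \<Rightarrow> complex) \<Rightarrow> (complex \<Rightarrow> complex) \<Rightarrow> complex" where
  "pairing r f g =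
     1 / (2 * of_real pi * \<i>) * contour_integral (circlepath 0 r) (\<lambda>x. f x * g x)"

definition basis_g :: "nat \<Rightarrow> nat \<Rightarrow> complex \<Rightarrow> complex" where
  "basis_g N l x = of_real ((-1) ^ l * pochhammer (- real N) l) * x ^ l"

definition basis_g_dual :: "nat \<Rightarrow> nat \<Rightarrow> complex \<Rightarrow> complex" where
  "basis_g_dual N l x =
     of_real ((-1) ^ l / pochhammer (- real N) l) * x powi (- int l - 1)"

definition fun_e :: "nat \<Rightarrow> real \<Rightarrow> real \<Rightarrow> real \<Rightarrow> nat \<Rightarrow> complex \<Rightarrow> complex" where
  "fun_e N \<alpha> \<beta> \<zeta> n x =
     of_real (pochhammer (- real N) n * pochhammer (real N - 2*\<alpha> - \<beta> - 2*\<zeta>) n /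
              pochhammer (real n - 2*\<beta> - 2*\<zeta> - 1) n) *
     (\<Sum>l=0..N. of_real ((-1) ^ l *
        (pochhammer (- real n) l * pochhammer (real n - 2*\<beta> - 2*\<zeta> - 1) l) /
        (fact l * (pochhammer (- real N) l * pochhammer (real N - 2*\<alpha> - \<beta> - 2*\<zeta>) l))) *
        basis_g N l x)"

definition fun_f_dual :: "nat \<Rightarrow> real \<Rightarrow> real \<Rightarrow> real \<Rightarrow> nat \<Rightarrow> complex \<Rightarrow> complex" where
  "fun_f_dual N \<alpha> \<beta> \<rho> n x =
     of_real (pochhammer (- \<beta> - \<rho>) n / (fact n * pochhammer (real n - 2*\<alpha> - \<rho>) n)) *
     (\<Sum>l=0..N. of_real ((-1) ^ l *
        (pochhammer (- real n) l * pochhammer (real n - 2*\<alpha> - \<rho>) l) /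
        pochhammer (- \<beta> - \<rho>) l) * basis_g_dual N l x)"

definition fun_d_dual :: "nat \<Rightarrow> real \<Rightarrow> real \<Rightarrow> nat \<Rightarrow> complex \<Rightarrow> complex" where
  "fun_d_dual N \<alpha> \<beta> n x =
     of_real (pochhammer (- real n + \<alpha> - \<beta>) n / (fact n * pochhammer (- \<alpha>) (n + 1))) *
     (\<Sum>l=0..N. of_real ((-1) ^ l *
        (pochhammer (- real n) l * pochhammer (- \<alpha>) l) /
        pochhammer (- real n + \<alpha> - \<beta>) l) * basis_g_dual N l x)"

definition fun_z_dual :: "nat \<Rightarrow> nat \<Rightarrow> complex \<Rightarrow> complex" where
  "fun_z_dual N n x =
     of_real (1 / pochhammer (- real n) n) *
     (\<Sum>l=0..N. of_real ((-1) ^ (l + n) * pochhammer (- real n) l) * basis_g_dual N l x)"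

definition racah_S :: "real \<Rightarrow> nat \<Rightarrow> real \<Rightarrow> real \<Rightarrow> real \<Rightarrow> real \<Rightarrow> nat \<Rightarrow> nat \<Rightarrow> complex" where
  "racah_S r N \<alpha> \<beta> \<zeta> \<rho> m n = pairing r (fun_f_dual N \<alpha> \<beta> \<rho> n) (fun_e N \<alpha> \<beta> \<zeta> m)"

definition racah_U :: "real \<Rightarrow> nat \<Rightarrow> real \<Rightarrow> real \<Rightarrow> real \<Rightarrow> nat \<Rightarrow> nat \<Rightarrow> complex" where
  "racah_U r N \<alpha> \<beta> \<zeta> m n = pairing r (fun_e N \<alpha> \<beta> \<zeta> m) (fun_d_dual N \<alpha> \<beta> n)"

text \<open>
  No denominator vanishes: the first six conditions concern the finite sums and their
  prefactors, the last two the denominator parameters of the non-terminating \<open>2F1\<close> series.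
  The factor \<open>n - \<alpha>\<close> in the formula for \<open>racah_U\<close> divides \<open>pochhammer (- \<alpha>) (n + 1)\<close>.
\<close>

definition generic :: "nat \<Rightarrow> real \<Rightarrow> real \<Rightarrow> real \<Rightarrow> real \<Rightarrow> bool" where
  "generic N \<alpha> \<beta> \<zeta> \<rho> \<longleftrightarrow>
     (\<forall>n\<le>N.
        pochhammer (real n - 2*\<beta> - 2*\<zeta> - 1) n \<noteq> 0 \<and>
        pochhammer (real N - 2*\<alpha> - \<beta> - 2*\<zeta>) n \<noteq> 0 \<and>
        pochhammer (real n - 2*\<alpha> - \<rho>) n \<noteq> 0 \<and>
        pochhammer (- \<beta> - \<rho>) n \<noteq> 0 \<and>
        pochhammer (- \<alpha>) (n + 1) \<noteq> 0 \<and>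
        (\<forall>l\<le>N. pochhammer (- real n + \<alpha> - \<beta>) l \<noteq> 0) \<and>
        1 + 2*\<alpha> + \<rho> - 2 * real n \<notin> \<int>\<^sub>\<le>\<^sub>0 \<and>
        \<alpha> - real n + 1 \<notin> \<int>\<^sub>\<le>\<^sub>0)"

end

theory Submission
  imports Defs "HOL-Real_Asymp.Real_Asymp"
begin

text \<open>
  Two observations give all the integral formulas.

  Up to a constant, \<open>fun_e\<close> is a Jacobi polynomial: the factors \<open>(-N)\<^sub>l\<close> and the signs in its
  summands cancel against those of \<open>basis_g\<close> (\<open>fun_e_eq_jacobi\<close>).

  Each of the dual functions \<open>f\<^sup>*\<close>, \<open>d\<^sup>*\<close>, \<open>z\<^sup>*\<close> with index \<open>n\<close> is a Laurent polynomial in which only the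
  powers \<open>x\<^sup>-\<^sup>1\<close>, ..., \<open>x\<^sup>-\<^sup>n\<^sup>-\<^sup>1\<close> occur. Reading it backwards, from \<open>x\<^sup>-\<^sup>n\<^sup>-\<^sup>1\<close> on, replaces every
  \<open>(c)\<^sub>n\<^sub>-\<^sub>j\<close> by a multiple of \<open>1 / (1 - c - n)\<^sub>j\<close>, so that upper and lower parameters change places
  (\<open>dual_coefficient_reversed\<close>). The result is a constant times
  \<open>x\<^sup>-\<^sup>n\<^sup>-\<^sup>1\<close> times a \<open>2F1\<close> series (for \<open>z\<^sup>*\<close> the binomial series of a negative power of \<open>1 - x\<close>), cut
  off after \<open>x\<^sup>n\<close>. Restoring the rest of the series does not change the pairing with a polynomial:
  it adds a function that is holomorphic inside the unit disc, where the series converges, and such a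
  function integrates to \<open>0\<close> (\<open>pairing_laurent_eq_contour_integral\<close>).

  For the dual Hahn polynomial, pairing \<open>fun_e\<close> with \<open>fun_z_dual\<close> term by term, without reversing,
  produces the terminating \<open>3F2\<close> at \<open>1\<close>.
\<close>

section \<open>Pairing a Laurent polynomial with a power series\<close>

text \<open>
  This is Cauchy's formula for the Taylor coefficients. All pairings are reduced to it, so that they
  become statements about coefficients of formal power series.
\<close>

lemma contour_integral_powi_eval_fps:
  assumes "0 < r" "ereal r < fps_conv_radius F"
  shows "((\<lambda>x. x powi (- int n - 1) * eval_fps F x) has_contour_integral
           (2 * of_real pi * \<i> * fps_nth F n)) (circlepath 0 r)"
proof -
  have sub: "cball 0 r \<subseteq> eball (0::complex) (fps_conv_radius F)"
  proof
    fix x :: complex assume "x \<in> cball 0 r"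
    then have "ereal (norm x) \<le> ereal r" by simp
    then show "x \<in> eball 0 (fps_conv_radius F)"
      using assms(2) by (simp add: in_eball_iff del: ereal_less_eq)
  qed
  have hol: "eval_fps F holomorphic_on eball 0 (fps_conv_radius F)"
    by (intro holomorphic_intros) auto
  have "eval_fps F has_fps_expansion F"
    by (rule eval_fps_has_fps_expansion)
       (use assms in \<open>auto intro: less_trans[of 0 "ereal r"]\<close>)
  then have nth: "fps_nth F n = (deriv ^^ n) (eval_fps F) 0 / fact n"
    by (rule fps_nth_fps_expansion)
  have "((\<lambda>x. eval_fps F x / (x - 0) ^ Suc n) has_contour_integral
          ((2 * pi * \<i>) / (fact n) * (deriv ^^ n) (eval_fps F) 0)) (circlepath 0 r)"
  proof (rule Cauchy_has_contour_integral_higher_derivative_circlepath)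
    show "continuous_on (cball 0 r) (eval_fps F)"
      using holomorphic_on_imp_continuous_on[OF hol] sub continuous_on_subset by blast
    show "eval_fps F holomorphic_on ball 0 r"
      by (rule holomorphic_on_subset[OF hol]) (use sub in auto)
  qed (use assms in auto)
  moreover have "eval_fps F x / (x - 0) ^ Suc n = x powi (- int n - 1) * eval_fps F x" for x
  proof -
    have "- int n - 1 = - int (Suc n)" by simp
    then have "x powi (- int n - 1) = inverse (x ^ Suc n)"
      by (metis power_int_minus power_int_of_nat)
    then show ?thesis by (simp add: divide_inverse mult.commute)
  qed
  ultimately show ?thesis by (simp add: nth)
qed

lemma pairing_commute: "pairing r f g = pairing r g f"
  by (simp add: pairing_def mult.commute)

lemma pairing_cong:
  assumes "0 < r" "\<And>x. norm x = r \<Longrightarrow> f x = f' x" "\<And>x. norm x = r \<Longrightarrow> g x = g' x"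
  shows "pairing r f g = pairing r f' g'"
  unfolding pairing_def
  by (rule arg_cong[where f = "\<lambda>I. 1 / (2 * of_real pi * \<i>) * I"], rule contour_integral_eq)
     (use assms in simp)

lemma pairing_laurent_eval_fps:
  assumes "finite A" "0 < r" "ereal r < fps_conv_radius U"
  shows "pairing r (\<lambda>x. \<Sum>l\<in>A. v l * x powi (- int l - 1)) (\<lambda>x. s * eval_fps U x)
           = s * (\<Sum>l\<in>A. v l * fps_nth U l)"
proof -
  have "((\<lambda>x. \<Sum>l\<in>A. (s * v l) * (x powi (- int l - 1) * eval_fps U x)) has_contour_integral
          (\<Sum>l\<in>A. (s * v l) * (2 * of_real pi * \<i> * fps_nth U l))) (circlepath 0 r)"
    using assms
    by (intro has_contour_integral_sum has_contour_integral_lmul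
        contour_integral_powi_eval_fps) auto
  moreover have "(\<lambda>x. \<Sum>l\<in>A. (s * v l) * (x powi (- int l - 1) * eval_fps U x))
      = (\<lambda>x. (\<Sum>l\<in>A. v l * x powi (- int l - 1)) * (s * eval_fps U x))"
    by (simp add: sum_distrib_left sum_distrib_right mult_ac)
  moreover have "(\<Sum>l\<in>A. (s * v l) * (2 * of_real pi * \<i> * fps_nth U l))
      = 2 * of_real pi * \<i> * (s * (\<Sum>l\<in>A. v l * fps_nth U l))"
    by (simp add: sum_distrib_left mult_ac)
  ultimately show ?thesis
    unfolding pairing_def by (simp add: contour_integral_unique)
qed

text \<open>
  The coefficient of \<open>x\<^sup>n\<close> in \<open>U * G\<close> involves \<open>G\<close> only up to \<open>x\<^sup>n\<close>. A Laurent polynomial whose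
  coefficients from \<open>x\<^sup>-\<^sup>n\<^sup>-\<^sup>1\<close> upwards are the first ones of \<open>K * G\<close> can therefore be replaced, under
  the integral, by \<open>K * x\<^sup>-\<^sup>n\<^sup>-\<^sup>1 * G\<close>.
\<close>

lemma pairing_laurent_eq_contour_integral:
  assumes r: "0 < r" "ereal r < fps_conv_radius U" "ereal r < fps_conv_radius G"
    and "n \<le> N"
    and beyond: "\<And>l. n < l \<Longrightarrow> l \<le> N \<Longrightarrow> v l = 0"
    and reversed: "\<And>j. j \<le> n \<Longrightarrow> v (n - j) = K * fps_nth G j"
  shows "pairing r (\<lambda>x. \<Sum>l=0..N. v l * x powi (- int l - 1)) (\<lambda>x. s * eval_fps U x)
    = s * K / (2 * of_real pi * \<i>) * contour_integral (circlepath 0 r)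
        (\<lambda>x. x powi (- int n - 1) * eval_fps U x * eval_fps G x)"
proof -
  have rUG: "ereal r < fps_conv_radius (U * G)"
    using r fps_conv_radius_mult[of U G] by (simp add: min_def less_le_trans split: if_splits)
  have "((\<lambda>x. x powi (- int n - 1) * eval_fps U x * eval_fps G x) has_contour_integral
          (2 * of_real pi * \<i> * fps_nth (U * G) n)) (circlepath 0 r)"
  proof (rule has_contour_integral_eq[OF contour_integral_powi_eval_fps[OF r(1) rUG]])
    fix x :: complex assume "x \<in> path_image (circlepath 0 r)"
    then have "norm x = r" using r by simp
    then have "eval_fps (U * G) x = eval_fps U x * eval_fps G x"
      using r by (intro eval_fps_mult) auto
    then show "x powi (- int n - 1) * eval_fps (U * G) x
        = x powi (- int n - 1) * eval_fps U x * eval_fps G x" by simp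
  qed
  then have int: "contour_integral (circlepath 0 r)
      (\<lambda>x. x powi (- int n - 1) * eval_fps U x * eval_fps G x)
      = 2 * of_real pi * \<i> * fps_nth (U * G) n"
    by (rule contour_integral_unique)
  have "(\<Sum>l=0..N. v l * fps_nth U l) = (\<Sum>l=0..n. v l * fps_nth U l)"
    using \<open>n \<le> N\<close> beyond by (intro sum.mono_neutral_right) auto
  also have "\<dots> = (\<Sum>l=0..n. K * (fps_nth U l * fps_nth G (n - l)))"
  proof (rule sum.cong)
    fix l assume "l \<in> {0..n}"
    then show "v l * fps_nth U l = K * (fps_nth U l * fps_nth G (n - l))"
      using reversed[of "n - l"] by simp
  qed simp
  also have "\<dots> = K * fps_nth (U * G) n"
    by (simp add: fps_mult_nth sum_distrib_left)
  finally have sum: "(\<Sum>l=0..N. v l * fps_nth U l) = K * fps_nth (U * G) n" .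
  have "s * K / c * (c * fps_nth (U * G) n) = s * (K * fps_nth (U * G) n)" if "c \<noteq> 0" for c
    using that by simp
  note cancel = this[of "2 * of_real pi * \<i>"]
  have "s * K / (2 * of_real pi * \<i>) * (2 * of_real pi * \<i> * fps_nth (U * G) n)
      = s * (K * fps_nth (U * G) n)"
    by (rule cancel) simp
  then show ?thesis
    using pairing_laurent_eval_fps[of "{0..N}" r U v s] r unfolding int sum
    by (simp only: finite_atLeastAtMost)
qed

section \<open>Reversing the dual functions\<close>

text \<open>
  The last \<open>j\<close> factors of \<open>pochhammer x n\<close>, in reverse order and with opposite signs, are those of
  \<open>pochhammer (1 - x - n) j\<close>.
\<close>

lemma pochhammer_reverse:
  fixes x :: "'a :: comm_ring_1"
  assumes "j \<le> n"
  shows "pochhammer x n = (-1) ^ j * pochhammer (1 - x - of_nat n) j * pochhammer x (n - j)"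
proof -
  have "pochhammer (1 - x - of_nat n) j = pochhammer (- (x + of_nat n - 1)) j"
    by (simp add: algebra_simps)
  also have "\<dots> = (-1) ^ j * pochhammer (x + of_nat (n - j)) j"
    using assms by (subst pochhammer_minus) (simp add: of_nat_diff algebra_simps)
  finally have "pochhammer (x + of_nat (n - j)) j = (-1) ^ j * pochhammer (1 - x - of_nat n) j"
    by (simp add: power_mult_distrib[symmetric] flip: mult.assoc)
  then show ?thesis
    using pochhammer_product[of "n - j" n x] assms by (simp add: mult_ac)
qed

text \<open>
  The common shape of the coefficients of \<open>fun_f_dual\<close>, \<open>fun_d_dual\<close> and \<open>fun_z_dual\<close>. By
  \<open>pochhammer_reverse\<close>, the numerator \<open>pochhammer x (n - j)\<close>, normalized by \<open>pochhammer x n\<close>, turns into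
  a denominator and the two denominators turn into numerators, while \<open>pochhammer (- n) (n - j)\<close>
  supplies the \<open>1 / fact j\<close> that makes the sequence hypergeometric.
\<close>

lemma dual_coefficient_reversed:
  fixes x y :: real
  assumes "j \<le> n" "n \<le> N" and x: "pochhammer x n \<noteq> 0" and y: "pochhammer y n \<noteq> 0"
  shows "pochhammer y n / (fact n * pochhammer x n) *
      ((-1) ^ (n - j) * (pochhammer (- real n) (n - j) * pochhammer x (n - j)) / pochhammer y (n - j)) *
      ((-1) ^ (n - j) / pochhammer (- real N) (n - j))
    = (-1) ^ n / pochhammer (- real N) n *
      (pochhammer (1 - y - real n) j * pochhammer (1 + real N - real n) j /
        (pochhammer (1 - x - real n) j * fact j))"
proof -
  note rev = pochhammer_reverse[OF \<open>j \<le> n\<close>]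
  have N: "pochhammer (- real N) n \<noteq> 0"
    using \<open>n \<le> N\<close> by (simp add: pochhammer_of_nat_eq_0_iff)
  have rN: "pochhammer (- real N) n
      = (-1) ^ j * pochhammer (1 + real N - real n) j * pochhammer (- real N) (n - j)"
    using rev[of "- real N"] by simp
  have sq: "(-1) ^ j * (-1) ^ j = (1 :: real)" by (simp flip: power_mult_distrib)
  have "(-1) ^ n * fact n = (-1) ^ j * fact j * pochhammer (- real n) (n - j)"
    using rev[of "- real n"] by (simp add: pochhammer_same pochhammer_fact)
  then have "(-1) ^ j * ((-1) ^ n * fact n) / fact j
      = ((-1) ^ j * (-1) ^ j) * pochhammer (- real n) (n - j)"
    by simp
  then have n: "pochhammer (- real n) (n - j) = (-1) ^ n * (-1) ^ j * fact n / fact j"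
    unfolding sq by (simp add: mult_ac)
  obtain t :: real where t: "(-1) ^ j = t" "t * t = 1" by (simp flip: power_mult_distrib)
  obtain u :: real where u: "(-1) ^ (n - j) = u" "u * u = 1" by (simp flip: power_mult_distrib)
  have nz: "pochhammer x (n - j) \<noteq> 0" "pochhammer (1 - x - real n) j \<noteq> 0"
    "pochhammer y (n - j) \<noteq> 0" "pochhammer (- real N) (n - j) \<noteq> 0" 
    "pochhammer (1 + real N - real n) j \<noteq> 0" "t \<noteq> 0"
    using x y N rev[of x] rev[of y] rN t by auto
  \<comment> \<open>With the signs and Pochhammer symbols as atoms, only monomials modulo \<open>t * t = u * u = 1\<close> remain.\<close>
  define X Y P x' y' N' where "X = pochhammer (1 - x - real n) j"
    and "Y = pochhammer (1 - y - real n) j" and "P = pochhammer (1 + real N - real n) j"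
    and "x' = pochhammer x (n - j)" and "y' = pochhammer y (n - j)"
    and "N' = pochhammer (- real N) (n - j)"
  note abbr = X_def Y_def P_def x'_def y'_def N'_def
  have "t * Y * y' / (fact n * (t * X * x')) * (u * ((-1) ^ n * t * fact n / fact j * x') / y') * (u / N')
      = (u * u) * ((-1) ^ n * t / N' * (Y / (X * fact j)))"
    using nz[folded abbr] by (simp add: divide_simps)
  also have "\<dots> = (t * t) * ((-1) ^ n / (t * P * N') * (Y * P / (X * fact j)))"
    unfolding u(2) using nz[folded abbr] by (simp add: divide_simps)
  finally show ?thesis
    unfolding n rev[of x] rev[of y] rN u(1) t(1) t(2) abbr by simp
qed

section \<open>Hypergeometric series\<close>

text \<open>
  The ratio \<open>\<tau>\<close> of consecutive coefficients tends to \<open>1\<close>. If \<open>c\<close> is a nonpositive integer then, since \<open>x / 0 = 0\<close>,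
  the coefficients vanish as soon as the denominator does, and the recurrence with \<open>\<tau>\<close>
  still holds.
\<close>

lemma fps_conv_radius_hypergeo_2F1:
  "fps_conv_radius (fps_hypergeo (map of_real [p, q]) (map of_real [c]) (1 :: complex)) \<ge> 1"
    (is "fps_conv_radius ?F \<ge> 1")
proof -
  define \<tau> where "\<tau> l = (p + real l) * (q + real l) / ((c + real l) * (real l + 1))" for l
  have rec: "fps_nth ?F (Suc l) = of_real (\<tau> l) * fps_nth ?F l" for l
    by (subst fps_hypergeo_rec) (simp add: \<tau>_def mult_ac)
  have "\<tau> \<longlonglongrightarrow> 1"
    unfolding \<tau>_def by real_asymp
  then have lim: "(\<lambda>l. norm (\<tau> l)) \<longlonglongrightarrow> 1"
    by (auto dest: tendsto_norm)
  show ?thesis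
    unfolding fps_conv_radius_def
  proof (rule conv_radius_geI_ex')
    fix s :: real assume s: "0 < s" "ereal s < 1"
    have "(\<lambda>l. norm (\<tau> l) * s) \<longlonglongrightarrow> 1 * s"
      by (intro tendsto_intros lim)
    moreover have "1 * s < (1 + s) / 2" using s by simp
    ultimately have "eventually (\<lambda>l. norm (\<tau> l) * s < (1 + s) / 2) sequentially"
      by (rule order_tendstoD)
    then obtain L where L: "\<And>l. l \<ge> L \<Longrightarrow> norm (\<tau> l) * s < (1 + s) / 2"
      by (auto simp: eventually_sequentially)
    show "summable (\<lambda>l. fps_nth ?F l * of_real s ^ l)"
    proof (rule summable_ratio_test[of "(1 + s) / 2" L])
      fix l assume "l \<ge> L"
      have "norm (fps_nth ?F (Suc l) * of_real s ^ Suc l)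
          = (norm (\<tau> l) * s) * norm (fps_nth ?F l * of_real s ^ l)"
        unfolding rec using s by (simp add: norm_mult norm_power del: fps_hypergeo_nth)
      also have "\<dots> \<le> (1 + s) / 2 * norm (fps_nth ?F l * of_real s ^ l)"
        using L[OF \<open>l \<ge> L\<close>] by (intro mult_right_mono) auto
      finally show "norm (fps_nth ?F (Suc l) * of_real s ^ Suc l)
          \<le> (1 + s) / 2 * norm (fps_nth ?F l * of_real s ^ l)" .
    qed (use s in auto)
  qed
qed

lemma fps_nth_hypergeo_2F1:
  "fps_nth (fps_hypergeo (map of_real [p, q]) (map of_real [c]) (1 :: complex)) l
     = of_real (pochhammer p l * pochhammer q l / (pochhammer c l * fact l))"
  by (simp add: pochhammer_of_real)

text \<open>
  The parameters \<open>1\<close> above and below cancel. They are kept so that the binomial series is an instance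
  of the same \<open>2F1\<close> series as the kernels of the other two integral formulas.
\<close>

lemma hypergeo_binomial:
  assumes "norm x < 1"
  shows "hypergeo [real p, 1] [1] x = (1 - x) powi (- int p)"
proof -
  have "(\<lambda>l. ((- of_nat p) gchoose l) * (- x) ^ l) sums (1 + (- x)) powr (- of_nat p)"
    using assms by (intro gen_binomial_complex) simp
  moreover have "((- of_nat p) gchoose l) * (- x) ^ l
      = fps_nth (fps_hypergeo (map of_real [real p, 1]) (map of_real [1]) 1) l * x ^ l" for l
  proof -
    have "((- of_nat p) gchoose l) * (- x) ^ l
        = pochhammer (of_nat p) l / fact l * ((-1) ^ l * (- x) ^ l)"
      by (simp add: gbinomial_pochhammer)
    also have "(-1) ^ l * (- x) ^ l = x ^ l"
      by (simp flip: power_mult_distrib)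
    finally show ?thesis
      by (simp add: pochhammer_fact[symmetric])
  qed
  ultimately have "hypergeo [real p, 1] [1] x = (1 + (- x)) powr (- of_nat p)"
    unfolding hypergeo_def eval_fps_def by (simp only: sums_iff)
  also have "\<dots> = (1 - x) powi (- int p)"
  proof -
    have "1 - x \<noteq> 0" using assms by auto
    then show ?thesis by (simp add: powr_minus powr_nat' power_int_minus)
  qed
  finally show ?thesis .
qed

lemma fps_nth_hypergeo_3F2:
  "fps_nth (fps_hypergeo (map of_real [p, q, s]) (map of_real [c, d]) (1 :: complex)) l
     = of_real (pochhammer p l * pochhammer q l * pochhammer s l /
         (pochhammer c l * pochhammer d l * fact l))"
  by (simp add: pochhammer_of_real)

lemma hypergeo_3F2_terminating:
  assumes "m \<le> N"
  shows "hypergeo [p, - real m, s] [c, d] 1 =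
    of_real (\<Sum>l=0..N. pochhammer p l * pochhammer (- real m) l * pochhammer s l /
      (pochhammer c l * pochhammer d l * fact l))"
proof -
  have zero: "pochhammer (- real m) l = 0" if "l \<notin> {0..N}" for l
    using that assms by (simp add: pochhammer_of_nat_eq_0_iff)
  show ?thesis
    unfolding hypergeo_def eval_fps_def fps_nth_hypergeo_3F2 power_one mult_1_right of_real_sum
    by (rule suminf_finite) (simp_all only: zero finite_atLeastAtMost not_False_eq_True mult_zero_left mult_zero_right div_0 of_real_0)
qed

section \<open>Jacobi polynomials as power series\<close>

definition jacobi_fps :: "nat \<Rightarrow> real \<Rightarrow> real \<Rightarrow> complex fps" where
  "jacobi_fps n a b = fps_const (of_real (pochhammer (a + 1) n / fact n)) *
     fps_hypergeo (map of_real [- real n, real n + a + b + 1]) (map of_real [a + 1]) 1"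

lemma fps_conv_radius_jacobi: "fps_conv_radius (jacobi_fps n a b) \<ge> 1"
  unfolding jacobi_fps_def
  by (rule order_trans[OF _ fps_conv_radius_mult])
     (simp only: fps_conv_radius_const min_def fps_conv_radius_hypergeo_2F1 split: if_split, simp)

lemma fps_nth_jacobi:
  "fps_nth (jacobi_fps n a b) l =
     of_real (pochhammer (a + 1) n / fact n *
       (pochhammer (- real n) l * pochhammer (real n + a + b + 1) l / (pochhammer (a + 1) l * fact l)))"
  unfolding jacobi_fps_def fps_mult_left_const_nth fps_nth_hypergeo_2F1 of_real_mult ..

lemma fps_nth_jacobi_beyond: "n < l \<Longrightarrow> fps_nth (jacobi_fps n a b) l = 0"
  by (simp add: fps_nth_jacobi pochhammer_of_nat_eq_0_iff)

lemma eval_jacobi_fps: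
  assumes "norm x < 1"
  shows "eval_fps (jacobi_fps n a b) x = jacobi_poly n a b x"
proof -
  let ?H = "fps_hypergeo (map of_real [- real n, real n + a + b + 1]) (map of_real [a + 1]) (1 :: complex)"
  have "ereal (norm x) < fps_conv_radius ?H"
    by (rule less_le_trans[OF _ fps_conv_radius_hypergeo_2F1]) (use assms in simp)
  then show ?thesis
    unfolding jacobi_fps_def jacobi_poly_def hypergeo_def
    by (subst eval_fps_mult) (simp_all del: list.map)
qed

text \<open>
  The product of the sign and \<open>pochhammer (- N) l\<close> in \<open>basis_g\<close> with their counterparts in the
  coefficient of \<open>fun_e\<close> is \<open>1\<close>, which leaves the Jacobi coefficients. The factor
  \<open>pochhammer (N - 2 * \<alpha> - \<beta> - 2 * \<zeta>) m\<close> in front of the sum is \<open>pochhammer (a + 1) m\<close>,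
  the normalization of the Jacobi polynomial.
\<close>

lemma fun_e_eq_jacobi:
  fixes N m :: nat and \<alpha> \<beta> \<zeta> a b :: real
  assumes "m \<le> N" "norm x < 1"
    and a: "a = real N - 2*\<alpha> - \<beta> - 2*\<zeta> - 1" and b: "b = 2*\<alpha> - \<beta> - real N - 1"
  shows "fun_e N \<alpha> \<beta> \<zeta> m x =
    of_real (fact m * pochhammer (- real N) m / pochhammer (real m - 2*\<beta> - 2*\<zeta> - 1) m) *
    eval_fps (jacobi_fps m a b) x"
proof -
  define C M where "C = real N - 2*\<alpha> - \<beta> - 2*\<zeta>" and "M = real m - 2*\<beta> - 2*\<zeta> - 1"
  have CM: "a + 1 = C" "real m + a + b + 1 = M"
    by (simp_all add: a b C_def M_def)
  have "eval_fps (jacobi_fps m a b) x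
      = (\<Sum>l=0..N. fps_nth (jacobi_fps m a b) l * x ^ l)"
    unfolding eval_fps_def
    by (rule suminf_finite) (use assms(1) in \<open>auto simp: fps_nth_jacobi_beyond\<close>)
  also have "\<dots> = (\<Sum>l=0..N. of_real (pochhammer C m / fact m) *
      (of_real ((-1) ^ l * (pochhammer (- real m) l * pochhammer M l) /
        (fact l * (pochhammer (- real N) l * pochhammer C l))) * basis_g N l x))"
  proof (rule sum.cong)
    fix l assume "l \<in> {0..N}"
    then have "pochhammer (- real N) l \<noteq> 0"
      by (simp add: pochhammer_of_nat_eq_0_iff)
    moreover obtain t :: real where "(-1) ^ l = t" "t * t = 1" by (simp flip: power_mult_distrib)
    ultimately have "pochhammer (- real m) l * pochhammer M l / (pochhammer C l * fact l)
        = (-1) ^ l * (pochhammer (- real m) l * pochhammer M l) /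
          (fact l * (pochhammer (- real N) l * pochhammer C l)) * ((-1) ^ l * pochhammer (- real N) l)"
      by (cases "pochhammer C l = 0") (simp_all add: divide_simps)
    then show "fps_nth (jacobi_fps m a b) l * x ^ l = of_real (pochhammer C m / fact m) *
      (of_real ((-1) ^ l * (pochhammer (- real m) l * pochhammer M l) /
        (fact l * (pochhammer (- real N) l * pochhammer C l))) * basis_g N l x)"
      unfolding fps_nth_jacobi CM basis_g_def by (simp only: of_real_mult mult.assoc)
  qed simp
  finally have J: "eval_fps (jacobi_fps m a b) x = of_real (pochhammer C m / fact m) *
      (\<Sum>l=0..N. of_real ((-1) ^ l * (pochhammer (- real m) l * pochhammer M l) /
        (fact l * (pochhammer (- real N) l * pochhammer C l))) * basis_g N l x)"
    by (simp only: sum_distrib_left)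
  have "pochhammer (- real N) m * pochhammer C m / pochhammer M m
      = fact m * pochhammer (- real N) m / pochhammer M m * (pochhammer C m / fact m)"
    by simp
  then show ?thesis
    unfolding J fun_e_def C_def[symmetric] M_def[symmetric]
    by (simp only: of_real_mult mult.assoc)
qed

section \<open>The integral formulas\<close>

lemma dual_laurent_form:
  "of_real \<kappa> * (\<Sum>l=0..N. of_real (w l) * basis_g_dual N l x)
     = (\<Sum>l=0..N. of_real (\<kappa> * w l * ((-1) ^ l / pochhammer (- real N) l)) * x powi (- int l - 1))"
  unfolding basis_g_dual_def sum_distrib_left by (simp only: of_real_mult mult.assoc)

text \<open>
  The three integral formulas are instances of this one. The premise \<open>reversed\<close> is what
  \<open>dual_coefficient_reversed\<close> provides.
\<close>

lemma pairing_fun_e_eq_contour_integral: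
  fixes N m n :: nat and \<alpha> \<beta> \<zeta> r a b :: real
  assumes r: "0 < r" "r < 1" and "m \<le> N" "n \<le> N"
    and a: "a = real N - 2*\<alpha> - \<beta> - 2*\<zeta> - 1" and b: "b = 2*\<alpha> - \<beta> - real N - 1"
    and F: "\<And>x. F x = of_real \<kappa> * (\<Sum>l=0..N. of_real (w l) * basis_g_dual N l x)"
    and beyond: "\<And>l. n < l \<Longrightarrow> w l = 0"
    and reversed: "\<And>j. j \<le> n \<Longrightarrow>
      \<kappa> * w (n - j) * ((-1) ^ (n - j) / pochhammer (- real N) (n - j)) =
        K * (pochhammer p j * pochhammer q j / (pochhammer d j * fact j))"
  shows "pairing r F (fun_e N \<alpha> \<beta> \<zeta> m) =
    1 / (2 * of_real pi * \<i>) *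
    of_real (fact m * pochhammer (- real N) m / pochhammer (real m - 2*\<beta> - 2*\<zeta> - 1) m * K) *
    contour_integral (circlepath 0 r)
      (\<lambda>x. x powi (- int n - 1) * jacobi_poly m a b x * hypergeo [p, q] [d] x)"
proof -
  let ?s = "fact m * pochhammer (- real N) m / pochhammer (real m - 2*\<beta> - 2*\<zeta> - 1) m"
  let ?v = "\<lambda>l. of_real (\<kappa> * w l * ((-1) ^ l / pochhammer (- real N) l)) :: complex"
  let ?J = "jacobi_fps m a b"
  let ?G = "fps_hypergeo (map of_real [p, q]) (map of_real [d]) (1 :: complex)"
  have radius: "ereal r < fps_conv_radius ?J" "ereal r < fps_conv_radius ?G"
    using r by (auto intro: less_le_trans[OF _ fps_conv_radius_jacobi]
        less_le_trans[OF _ fps_conv_radius_hypergeo_2F1] simp del: list.map)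
  have "pairing r F (fun_e N \<alpha> \<beta> \<zeta> m)
      = pairing r (\<lambda>x. \<Sum>l=0..N. ?v l * x powi (- int l - 1)) (\<lambda>x. of_real ?s * eval_fps ?J x)"
    using r \<open>m \<le> N\<close> fun_e_eq_jacobi[OF _ _ a b]
    by (intro pairing_cong) (simp_all add: F dual_laurent_form del: of_real_mult of_real_divide)
  also have "\<dots> = of_real ?s * of_real K / (2 * of_real pi * \<i>) *
      contour_integral (circlepath 0 r)
        (\<lambda>x. x powi (- int n - 1) * eval_fps ?J x * eval_fps ?G x)"
  proof (rule pairing_laurent_eq_contour_integral[OF r(1) radius \<open>n \<le> N\<close>])
    show "?v (n - j) = of_real K * fps_nth ?G j" if "j \<le> n" for j
      unfolding fps_nth_hypergeo_2F1 reversed[OF that] of_real_mult ..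
  qed (simp add: beyond)
  also have "contour_integral (circlepath 0 r)
        (\<lambda>x. x powi (- int n - 1) * eval_fps ?J x * eval_fps ?G x)
      = contour_integral (circlepath 0 r)
        (\<lambda>x. x powi (- int n - 1) * jacobi_poly m a b x * hypergeo [p, q] [d] x)"
    by (rule contour_integral_eq) (use r in \<open>simp add: eval_jacobi_fps hypergeo_def\<close>)
  also have "of_real ?s * of_real K / (2 * of_real pi * \<i>)
      = 1 / (2 * of_real pi * \<i>) * of_real (?s * K)"
    by (simp add: mult_ac)
  finally show ?thesis .
qed

theorem corollary2:
  fixes N m n k :: nat and \<alpha> \<beta> \<zeta> \<rho> r a b :: real
  assumes N: "N > 0"
    and generic: "generic N \<alpha> \<beta> \<zeta> \<rho>"
    and r: "0 < r" "r < 1"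
    and mnk: "m \<le> N" "n \<le> N" "k \<le> N"
    and a: "a = real N - 2*\<alpha> - \<beta> - 2*\<zeta> - 1"
    and b: "b = 2*\<alpha> - \<beta> - real N - 1"
  shows
    "racah_S r N \<alpha> \<beta> \<zeta> \<rho> m n =
       (-1) ^ n / (2 * of_real pi * \<i>) *
       of_real (fact m * pochhammer (- real N) m /
         (pochhammer (- real N) n * pochhammer (real m - 2*\<beta> - 2*\<zeta> - 1) m)) *
       contour_integral (circlepath 0 r)
         (\<lambda>x. x powi (- int n - 1) * jacobi_poly m a b x *
              hypergeo [1 + \<beta> + \<rho> - real n, 1 + real N - real n]
                       [1 + 2*\<alpha> + \<rho> - 2 * real n] x) \<and>
     racah_U r N \<alpha> \<beta> \<zeta> m n =
       (-1) ^ n / (2 * of_real pi * \<i>) *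
       of_real (fact m * pochhammer (- real N) m /
         (pochhammer (- real N) n * (real n - \<alpha>) *
          pochhammer (real m - 2*\<beta> - 2*\<zeta> - 1) m)) *
       contour_integral (circlepath 0 r)
         (\<lambda>x. x powi (- int n - 1) * jacobi_poly m a b x *
              hypergeo [real N + 1 - real n, \<beta> - \<alpha> + 1] [\<alpha> - real n + 1] x) \<and>
     dual_hahn k m a b N =
       hypergeo [- real k, - real m, real m - 2*\<beta> - 2*\<zeta> - 1]
                [real N - 2*\<alpha> - \<beta> - 2*\<zeta>, - real N] 1 \<and>
     dual_hahn k m a b N =
       of_real (fact k * pochhammer (real m - 2*\<beta> - 2*\<zeta> - 1) m /
         (pochhammer (- real N) m * pochhammer (real N - 2*\<alpha> - \<beta> - 2*\<zeta>) m)) *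
       pairing r (fun_e N \<alpha> \<beta> \<zeta> m) (fun_z_dual N k) \<and>
     dual_hahn k m a b N =
       (-1) ^ k / (2 * of_real pi * \<i>) *
       of_real (fact m * fact k /
         (pochhammer (real N - 2*\<alpha> - \<beta> - 2*\<zeta>) m * pochhammer (- real N) k)) *
       contour_integral (circlepath 0 r)
         (\<lambda>x. x powi (- int k - 1) * (1 - x) powi (int k - 1 - int N) * jacobi_poly m a b x)"

proof -
  define C M where "C = real N - 2*\<alpha> - \<beta> - 2*\<zeta>" and "M = real m - 2*\<beta> - 2*\<zeta> - 1"
  have CM: "a + 1 = C" "real m + a + b + 1 = M"
    by (simp_all add: a b C_def M_def)
  note gen = generic[unfolded generic_def, rule_format]
  have C: "pochhammer C m \<noteq> 0" and M: "pochhammer M m \<noteq> 0"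
    using gen[OF \<open>m \<le> N\<close>] by (simp_all add: C_def M_def)
  have N_m: "pochhammer (- real N) m \<noteq> 0"
    using mnk by (simp add: pochhammer_of_nat_eq_0_iff)
  have beyond: "pochhammer (- real i) l = 0" if "i < l" for i l
    using that by (simp add: pochhammer_of_nat_eq_0_iff)
  note pair = pairing_fun_e_eq_contour_integral[OF r \<open>m \<le> N\<close> _ a b]

  have S: "racah_S r N \<alpha> \<beta> \<zeta> \<rho> m n =
    1 / (2 * of_real pi * \<i>) *
    of_real (fact m * pochhammer (- real N) m / pochhammer M m * ((-1) ^ n / pochhammer (- real N) n)) *
    contour_integral (circlepath 0 r)
      (\<lambda>x. x powi (- int n - 1) * jacobi_poly m a b x *
        hypergeo [1 + \<beta> + \<rho> - real n, 1 + real N - real n] [1 + 2*\<alpha> + \<rho> - 2 * real n] x)"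
    unfolding racah_S_def M_def
  proof (rule pair[OF \<open>n \<le> N\<close> fun_f_dual_def])
    fix j assume "j \<le> n"
    have "1 - (- \<beta> - \<rho>) - real n = 1 + \<beta> + \<rho> - real n"
      "1 - (real n - 2*\<alpha> - \<rho>) - real n = 1 + 2*\<alpha> + \<rho> - 2 * real n" by simp_all
    then show "pochhammer (- \<beta> - \<rho>) n / (fact n * pochhammer (real n - 2*\<alpha> - \<rho>) n) *
        ((-1) ^ (n - j) * (pochhammer (- real n) (n - j) * pochhammer (real n - 2*\<alpha> - \<rho>) (n - j)) /
          pochhammer (- \<beta> - \<rho>) (n - j)) * ((-1) ^ (n - j) / pochhammer (- real N) (n - j))
      = (-1) ^ n / pochhammer (- real N) n *
        (pochhammer (1 + \<beta> + \<rho> - real n) j * pochhammer (1 + real N - real n) j /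
          (pochhammer (1 + 2*\<alpha> + \<rho> - 2 * real n) j * fact j))"
      using dual_coefficient_reversed[OF \<open>j \<le> n\<close> \<open>n \<le> N\<close>,
          of "real n - 2*\<alpha> - \<rho>" "- \<beta> - \<rho>"] gen[OF \<open>n \<le> N\<close>] by metis
  qed (simp add: beyond)

  have U: "racah_U r N \<alpha> \<beta> \<zeta> m n =
    1 / (2 * of_real pi * \<i>) *
    of_real (fact m * pochhammer (- real N) m / pochhammer M m *
      ((-1) ^ n / (pochhammer (- real N) n * (real n - \<alpha>)))) *
    contour_integral (circlepath 0 r)
      (\<lambda>x. x powi (- int n - 1) * jacobi_poly m a b x *
        hypergeo [real N + 1 - real n, \<beta> - \<alpha> + 1] [\<alpha> - real n + 1] x)"
    unfolding racah_U_def M_def pairing_commute[of r "fun_e N \<alpha> \<beta> \<zeta> m"]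
  proof (rule pair[OF \<open>n \<le> N\<close> fun_d_dual_def])
    fix j assume "j \<le> n"
    let ?y = "- real n + \<alpha> - \<beta>"
    let ?u = "(-1) ^ (n - j) * (pochhammer (- real n) (n - j) * pochhammer (- \<alpha>) (n - j)) /
          pochhammer ?y (n - j)"
    let ?g = "(-1) ^ (n - j) / pochhammer (- real N) (n - j)"
    \<comment> \<open>Splitting off the last factor \<open>n - \<alpha>\<close> leaves the coefficients in the common shape.\<close>
    have "pochhammer (- \<alpha>) (n + 1) \<noteq> 0" "pochhammer ?y n \<noteq> 0"
      using gen[OF \<open>n \<le> N\<close>] \<open>n \<le> N\<close> by auto
    moreover have split: "pochhammer (- \<alpha>) (n + 1) = pochhammer (- \<alpha>) n * (real n - \<alpha>)"
      by (simp add: pochhammer_Suc)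
    ultimately have "pochhammer ?y n / (fact n * pochhammer (- \<alpha>) n) * ?u * ?g
      = (-1) ^ n / pochhammer (- real N) n *
        (pochhammer (1 - ?y - real n) j * pochhammer (1 + real N - real n) j /
          (pochhammer (1 - - \<alpha> - real n) j * fact j))"
      by (intro dual_coefficient_reversed[OF \<open>j \<le> n\<close> \<open>n \<le> N\<close>]) auto
    moreover have "1 - ?y - real n = \<beta> - \<alpha> + 1" "1 + real N - real n = real N + 1 - real n"
      "1 - - \<alpha> - real n = \<alpha> - real n + 1" by simp_all
    ultimately have "pochhammer ?y n / (fact n * pochhammer (- \<alpha>) n) * ?u * ?g / (real n - \<alpha>)
      = (-1) ^ n / pochhammer (- real N) n *
        (pochhammer (\<beta> - \<alpha> + 1) j * pochhammer (real N + 1 - real n) j /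
          (pochhammer (\<alpha> - real n + 1) j * fact j)) / (real n - \<alpha>)"
      by (simp only:)
    then show "pochhammer ?y n / (fact n * pochhammer (- \<alpha>) (n + 1)) * ?u * ?g
      = (-1) ^ n / (pochhammer (- real N) n * (real n - \<alpha>)) *
        (pochhammer (real N + 1 - real n) j * pochhammer (\<beta> - \<alpha> + 1) j /
          (pochhammer (\<alpha> - real n + 1) j * fact j))"
      unfolding split by (simp only: times_divide_eq_left times_divide_eq_right divide_divide_eq_left
          mult.assoc mult.commute mult.left_commute)
  qed (simp add: beyond)

  have R: "dual_hahn k m a b N = hypergeo [- real k, - real m, M] [C, - real N] 1"
    unfolding dual_hahn_def CM ..

  have k_k: "pochhammer (- real k) k = (-1) ^ k * fact k"
    by (rule pochhammer_same)

  have "pairing r (fun_e N \<alpha> \<beta> \<zeta> m) (fun_z_dual N k)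
      = pairing r (\<lambda>x. \<Sum>l=0..N. of_real (1 / pochhammer (- real k) k *
            ((-1) ^ (l + k) * pochhammer (- real k) l) * ((-1) ^ l / pochhammer (- real N) l)) *
            x powi (- int l - 1))
          (\<lambda>x. of_real (fact m * pochhammer (- real N) m / pochhammer M m) *
            eval_fps (jacobi_fps m a b) x)"
    unfolding pairing_commute[of r "fun_e N \<alpha> \<beta> \<zeta> m"] M_def
    using r \<open>m \<le> N\<close> fun_e_eq_jacobi[OF _ _ a b]
    by (intro pairing_cong)
       (simp_all only: fun_z_dual_def dual_laurent_form)
  also have "\<dots> = of_real (fact m * pochhammer (- real N) m / pochhammer M m) *
      (\<Sum>l=0..N. of_real (1 / pochhammer (- real k) k *
            ((-1) ^ (l + k) * pochhammer (- real k) l) * ((-1) ^ l / pochhammer (- real N) l)) *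
          fps_nth (jacobi_fps m a b) l)"
    by (rule pairing_laurent_eval_fps)
       (use r in \<open>auto intro: less_le_trans[OF _ fps_conv_radius_jacobi]\<close>)
  also have "\<dots> = of_real (pochhammer (- real N) m * pochhammer C m / (fact k * pochhammer M m)) *
      hypergeo [- real k, - real m, M] [C, - real N] 1"
  proof -
    have "fact m * pochhammer (- real N) m / pochhammer M m *
          (1 / pochhammer (- real k) k * ((-1) ^ (l + k) * pochhammer (- real k) l) *
            ((-1) ^ l / pochhammer (- real N) l) *
          (pochhammer C m / fact m *
            (pochhammer (- real m) l * pochhammer M l / (pochhammer C l * fact l))))
      = pochhammer (- real N) m * pochhammer C m / (fact k * pochhammer M m) *
          (pochhammer (- real k) l * pochhammer (- real m) l * pochhammer M l /
            (pochhammer C l * pochhammer (- real N) l * fact l))" for l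
    proof -
      obtain t :: real where t: "(-1) ^ l = t" "t * t = 1" by (simp flip: power_mult_distrib)
      obtain u :: real where u: "(-1) ^ k = u" "u * u = 1" by (simp flip: power_mult_distrib)
      have "u \<noteq> 0" using u by auto
      then show ?thesis
        using t(2) unfolding k_k power_add t(1) u(1) by (simp add: mult_ac)
    qed
    then show ?thesis
      unfolding hypergeo_3F2_terminating[OF \<open>m \<le> N\<close>] fps_nth_jacobi CM sum_distrib_left
        of_real_mult[symmetric] of_real_sum[symmetric]
      by (simp only:)
  qed
  finally have Z: "dual_hahn k m a b N =
      of_real (fact k * pochhammer M m / (pochhammer (- real N) m * pochhammer C m)) *
      pairing r (fun_e N \<alpha> \<beta> \<zeta> m) (fun_z_dual N k)"
    using N_m C M by (simp add: R)

  have "pairing r (fun_e N \<alpha> \<beta> \<zeta> m) (fun_z_dual N k) =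
    1 / (2 * of_real pi * \<i>) *
    of_real (fact m * pochhammer (- real N) m / pochhammer M m * ((-1) ^ k / pochhammer (- real N) k)) *
    contour_integral (circlepath 0 r)
      (\<lambda>x. x powi (- int k - 1) * jacobi_poly m a b x * hypergeo [real (N + 1 - k), 1] [1] x)"
    unfolding M_def pairing_commute[of r "fun_e N \<alpha> \<beta> \<zeta> m"]
  proof (rule pair[OF \<open>k \<le> N\<close> fun_z_dual_def])
    fix j assume "j \<le> k"
    have Nk: "1 + real N - real k = real (N + 1 - k)"
      using \<open>k \<le> N\<close> by (simp add: of_nat_diff)
    have nz: "pochhammer 1 i \<noteq> (0 :: real)" "pochhammer (- real k) j \<noteq> 0" for i
      using \<open>j \<le> k\<close> by (simp_all add: pochhammer_fact[symmetric] pochhammer_of_nat_eq_0_iff)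
    \<comment> \<open>Both \<open>x\<close> and \<open>y\<close> of the common shape are \<open>1\<close>: their contributions cancel before the reversal,
      where they are factorials, and after it, where they are \<open>pochhammer (- k) j\<close> with \<open>j \<le> k\<close>.\<close>
    have "1 / pochhammer (- real k) k * ((-1) ^ ((k - j) + k) * pochhammer (- real k) (k - j))
      = pochhammer 1 k / (fact k * pochhammer 1 k) *
        ((-1) ^ (k - j) * (pochhammer (- real k) (k - j) * pochhammer 1 (k - j)) / pochhammer 1 (k - j))"
      unfolding k_k power_add using nz by simp
    then show "1 / pochhammer (- real k) k * ((-1) ^ ((k - j) + k) * pochhammer (- real k) (k - j)) *
        ((-1) ^ (k - j) / pochhammer (- real N) (k - j))
      = (-1) ^ k / pochhammer (- real N) k *
        (pochhammer (real (N + 1 - k)) j * pochhammer 1 j / (pochhammer 1 j * fact j))"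
      using dual_coefficient_reversed[OF \<open>j \<le> k\<close> \<open>k \<le> N\<close>, of 1 1] nz
      unfolding Nk by simp
  qed (simp add: beyond)
  also have "contour_integral (circlepath 0 r)
      (\<lambda>x. x powi (- int k - 1) * jacobi_poly m a b x * hypergeo [real (N + 1 - k), 1] [1] x)
    = contour_integral (circlepath 0 r)
      (\<lambda>x. x powi (- int k - 1) * (1 - x) powi (int k - 1 - int N) * jacobi_poly m a b x)"
  proof (rule contour_integral_eq)
    fix x :: complex assume "x \<in> path_image (circlepath 0 r)"
    then have "norm x < 1" using r by simp
    moreover have "- int (N + 1 - k) = int k - 1 - int N"
      using \<open>k \<le> N\<close> by (simp add: of_nat_diff)
    ultimately show "x powi (- int k - 1) * jacobi_poly m a b x * hypergeo [real (N + 1 - k), 1] [1] x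
        = x powi (- int k - 1) * (1 - x) powi (int k - 1 - int N) * jacobi_poly m a b x"
      using hypergeo_binomial[of x "N + 1 - k"] by (simp only: mult_ac)
  qed
  finally have P: "pairing r (fun_e N \<alpha> \<beta> \<zeta> m) (fun_z_dual N k) =
    1 / (2 * of_real pi * \<i>) *
    of_real (fact m * pochhammer (- real N) m / pochhammer M m * ((-1) ^ k / pochhammer (- real N) k)) *
    contour_integral (circlepath 0 r)
      (\<lambda>x. x powi (- int k - 1) * (1 - x) powi (int k - 1 - int N) * jacobi_poly m a b x)" .
  have Z': "dual_hahn k m a b N =
       (-1) ^ k / (2 * of_real pi * \<i>) *
       of_real (fact m * fact k / (pochhammer C m * pochhammer (- real N) k)) *
       contour_integral (circlepath 0 r)
         (\<lambda>x. x powi (- int k - 1) * (1 - x) powi (int k - 1 - int N) * jacobi_poly m a b x)"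
    unfolding Z P using N_m C M by (simp add: mult_ac)
  show ?thesis
    unfolding C_def[symmetric] M_def[symmetric]
    using S U R Z Z' by (simp add: mult_ac)
qed
end
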